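(* Let $h>0$, $u_m\in\mathbb{R}$, $\boldsymbol{\alpha}=(\alpha_1,\dots,\alpha_N)^{\rm T}\in\mathbb{R}^N$, and let $\nu,\rho,g,n>0$. The Newtonian Manning friction term $$\mathbf{S}_{\rm NM}(\boldsymbol{u}) = -\frac{\rho g n^2}{h^{1/3}}\,|u_b|\,u_b \begin{pmatrix} 0 \\ 1\\ \boldsymbol{r} \end{pmatrix} - \frac{\nu}{h} \begin{pmatrix} 0 \\ 0\\ \boldsymbol{C}\boldsymbol{\alpha} \end{pmatrix}\in\mathbb{R}^{N+2}$$ is entropy dissipative with respect to the entropy variables $\boldsymbol{w}$, namely $\boldsymbol{w}^{\rm T}\,\mathbf{S}_{\rm NM}(\boldsymbol{u})\leq 0$.
   Context: $N\ge1$ is an integer, $\boldsymbol{u}=(h,hu_m,h\alpha_1,\dots,h\alpha_N)^{\rm T}$, $u_b=u_m+\alpha_1+\cdots+\alpha_N$ is the bottom velocity, $\boldsymbol{r}\in\mathbb{R}^N$ has components $r_i=2i+1$, and $\boldsymbol{C}=(C_{ij})\in\mathbb{R}^{N\times N}$ is given by $$C_{ij} = (2i+1)\int_0^1\phi_i'(\zeta)\phi_j'(\zeta)\,{\rm d}\zeta,\qquad i,j=1,\dots,N,$$ where $\phi_i(\zeta)=(-1)^iL_i(2\zeta-1)$ on $[0,1]$ and $L_i$ are the classical Legendre polynomials ($L_i(1)=1$). Here $n$ is the Manning coefficient, $\rho$ the constant density, $\nu$ a viscosity parameter and $g$ the gravitational constant. The entropy variables $\boldsymbol{w}\in\mathbb{R}^{N+2}$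 are $$w_1=-\frac{u_m^2}{2}-\frac12\sum_{i=1}^N\frac{\alpha_i^2}{2i+1}+g(h+b),\quad w_2=u_m,\quad w_{i+2}=\frac{\alpha_i}{2i+1}\ (i=1,\dots,N),$$ with $b\in\mathbb{R}$ the bathymetry value. *)

theory Defs
  imports
    "HOL-Analysis.Henstock_Kurzweil_Integration"
    "HOL-Computational_Algebra.Polynomial"
    "Jordan_Normal_Form.Matrix"
begin

text \<open>
  Vectors and matrices are those of \<^theory>\<open>Jordan_Normal_Form.Matrix\<close>, whose indices start
  at 0. Entry \<open>i\<close> of an \<open>N\<close>-vector therefore belongs to the mode with number \<open>i + 1\<close>, and
  entry \<open>i\<close> of a state vector is component \<open>i + 1\<close> of the state.
\<close>

text \<open>Classical Legendre polynomials by Rodrigues' formula.\<close>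

definition legendre :: "nat \<Rightarrow> real poly" where
  "legendre i = Polynomial.smult (1 / (2 ^ i * fact i)) ((pderiv ^^ i) ([:-1, 0, 1:] ^ i))"

lemma poly_pderiv_funpow_at_1:
  "poly ((pderiv ^^ i) ([:-1, 1:] ^ i * q)) 1 = fact i * poly q (1::real)"
proof (induction i arbitrary: q)
  case 0
  show ?case by simp
next
  case (Suc i)
  have "pderiv ([:-1, 1:] ^ Suc i * q)
      = [:-1, 1:] ^ i * (Polynomial.smult (of_nat (Suc i)) q + [:-1, 1:] * pderiv q)"
    by (simp only: pderiv_mult pderiv_power_Suc) (simp add: algebra_simps pderiv_pCons)
  then show ?case
    by (simp only: funpow_Suc_right o_apply Suc.IH) simp
qed

lemma legendre_at_1: "poly (legendre i) 1 = 1"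
proof -
  have "([:-1, 0, 1:] :: real poly) = [:-1, 1:] * [:1, 1:]" by simp
  then show ?thesis
    by (simp only: legendre_def power_mult_distrib poly_smult poly_pderiv_funpow_at_1)
      (simp add: poly_power)
qed

text \<open>
  The basis functions are only used on \<open>[0,1]\<close>. Being polynomials they are defined by the same
  formula on all of \<open>\<real>\<close>, so that the two-sided derivative exists also at 0 and 1.
\<close>

definition basis_fun :: "nat \<Rightarrow> real \<Rightarrow> real" where
  "basis_fun i \<zeta> = (-1) ^ i * poly (legendre i) (2 * \<zeta> - 1)"

definition C_mat :: "nat \<Rightarrow> real mat" where
  "C_mat N = mat N N (\<lambda>(i, j). real (2 * (i + 1) + 1) *
     integral {0..1} (\<lambda>\<zeta>. deriv (basis_fun (i + 1)) \<zeta> * deriv (basis_fun (j + 1)) \<zeta>))"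

definition r_vec :: "nat \<Rightarrow> real vec" where
  "r_vec N = vec N (\<lambda>i. real (2 * (i + 1) + 1))"

definition state :: "real \<Rightarrow> real \<Rightarrow> real vec \<Rightarrow> real vec" where
  "state h u\<^sub>m \<alpha> = vCons h (vCons (h * u\<^sub>m) (h \<cdot>\<^sub>v \<alpha>))"

text \<open>Recovery of the primitive variables from a state with nonzero height.\<close>

definition height :: "real vec \<Rightarrow> real" where
  "height u = u $ 0"

definition mean_velocity :: "real vec \<Rightarrow> real" where
  "mean_velocity u = u $ 1 / height u"

definition moments :: "real vec \<Rightarrow> real vec" where
  "moments u = vec (dim_vec u - 2) (\<lambda>i. u $ (i + 2) / height u)"

lemma height_state [simp]: "height (state h u\<^sub>m \<alpha>) = h"
  by (simp add: height_def state_def)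

lemma mean_velocity_state [simp]: "h \<noteq> 0 \<Longrightarrow> mean_velocity (state h u\<^sub>m \<alpha>) = u\<^sub>m"
  by (simp add: mean_velocity_def height_def state_def)

lemma moments_state [simp]: "h \<noteq> 0 \<Longrightarrow> moments (state h u\<^sub>m \<alpha>) = \<alpha>"
  by (rule eq_vecI) (simp_all add: moments_def height_def state_def)

definition bottom_velocity :: "real vec \<Rightarrow> real" where
  "bottom_velocity u = mean_velocity u + (\<Sum>i<dim_vec (moments u). moments u $ i)"

definition S_NM :: "real \<Rightarrow> real \<Rightarrow> real \<Rightarrow> real \<Rightarrow> real vec \<Rightarrow> real vec" where
  "S_NM \<nu> \<rho> g n u =
    (let N = dim_vec (moments u); h = height u; u\<^sub>b = bottom_velocity u in
      - (\<rho> * g * n\<^sup>2 / h powr (1 / 3) * \<bar>u\<^sub>b\<bar> * u\<^sub>b) \<cdot>\<^sub>v vCons 0 (vCons 1 (r_vec N))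
      - (\<nu> / h) \<cdot>\<^sub>v vCons 0 (vCons 0 (C_mat N *\<^sub>v moments u)))"

definition entropy_vars :: "real \<Rightarrow> real \<Rightarrow> real vec \<Rightarrow> real vec" where
  "entropy_vars g b u =
    (let N = dim_vec (moments u); h = height u; u\<^sub>m = mean_velocity u; \<alpha> = moments u in
      vCons (- (u\<^sub>m\<^sup>2 / 2) - 1 / 2 * (\<Sum>i<N. (\<alpha> $ i)\<^sup>2 / real (2 * (i + 1) + 1)) + g * (h + b))
        (vCons u\<^sub>m (vec N (\<lambda>i. \<alpha> $ i / real (2 * (i + 1) + 1)))))"

end

theory Submission
  imports Defs
begin

text \<open>
  The weights \<open>1 / (2 i + 1)\<close> in the entropy variables cancel the factors \<open>2 i + 1\<close> in both the
  vector \<open>r\<close> and the matrix \<open>C\<close>. Against the Manning direction \<open>(0, 1, r)\<close> the entropy variables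
  therefore sum the mean velocity and all moments, which gives the bottom velocity \<open>u\<^sub>b\<close>
  (\<open>entropy_vars_inner_Manning_direction\<close>), so bottom friction contributes a nonpositive
  multiple of \<open>\<bar>u\<^sub>b\<bar> * u\<^sub>b\<^sup>2\<close>. Against the viscous direction
  \<open>(0, 0, C \<alpha>)\<close> what remains is the quadratic form of the Gram matrix of the derivatives of the
  basis functions in \<open>L\<^sup>2(0,1)\<close>. It equals the squared norm of the shear \<open>\<Sum>\<^sub>i \<alpha>\<^sub>i \<phi>\<^sub>i'\<close>
  (\<open>weighted_C_mat_quadratic_form\<close>), so viscosity contributes \<open>- \<nu> / h\<close> times a
  nonnegative number. Both directions start with 0 because friction leaves the mass balance
  alone, so the sign-indefinite first entropy variable does not enter.
\<close>

lemma continuous_on_deriv_basis_fun: "continuous_on A (deriv (basis_fun i))"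
proof -
  have "(basis_fun i has_real_derivative
      (-1) ^ i * (poly (pderiv (legendre i)) (2 * \<zeta> - 1) * 2)) (at \<zeta>)" for \<zeta>
    unfolding basis_fun_def
    by (auto intro!: derivative_eq_intros DERIV_chain2[OF poly_DERIV])
  then have "deriv (basis_fun i)
      = (\<lambda>\<zeta>. (-1) ^ i * (poly (pderiv (legendre i)) (2 * \<zeta> - 1) * 2))"
    by (intro ext DERIV_imp_deriv)
  then show ?thesis
    by (auto intro!: continuous_intros)
qed

text \<open>
  The quadratic form of a Gram matrix is a squared norm: by bilinearity of the \<open>L\<^sup>2\<close> product the
  finite double sum can be moved inside the integral, where it factors as a square.
\<close>

lemma Gram_quadratic_form:
  fixes f :: "nat \<Rightarrow> real \<Rightarrow> real" and c :: "nat \<Rightarrow> real"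
  assumes "\<And>i. continuous_on {a..b} (f i)"
  shows "(\<Sum>i<N. c i * (\<Sum>j<N. integral {a..b} (\<lambda>x. f i x * f j x) * c j))
    = integral {a..b} (\<lambda>x. (\<Sum>i<N. c i * f i x)\<^sup>2)"
proof -
  have int: "(\<lambda>x. c i * f i x * (c j * f j x)) integrable_on {a..b}" for i j
    by (intro integrable_continuous_interval continuous_on_mult continuous_on_const assms)
  have "integral {a..b} (\<lambda>x. (\<Sum>i<N. c i * f i x)\<^sup>2)
      = integral {a..b} (\<lambda>x. \<Sum>i<N. \<Sum>j<N. c i * f i x * (c j * f j x))"
    by (simp add: power2_eq_square sum_product)
  also have "\<dots> = (\<Sum>i<N. \<Sum>j<N. integral {a..b} (\<lambda>x. c i * f i x * (c j * f j x)))"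
    by (simp only: Henstock_Kurzweil_Integration.integral_sum integrable_sum int finite_lessThan)
  also have "\<dots> = (\<Sum>i<N. \<Sum>j<N. c i * c j * integral {a..b} (\<lambda>x. f i x * f j x))"
  proof (intro sum.cong refl)
    fix i j
    have "(\<lambda>x. c i * f i x * (c j * f j x)) = (\<lambda>x. c i * c j * (f i x * f j x))"
      by (simp add: mult_ac)
    then show "integral {a..b} (\<lambda>x. c i * f i x * (c j * f j x))
        = c i * c j * integral {a..b} (\<lambda>x. f i x * f j x)"
      by (simp only: integral_mult_right)
  qed
  finally show ?thesis
    by (simp add: sum_distrib_left mult_ac)
qed

lemma weighted_C_mat_quadratic_form:
  assumes "\<alpha> \<in> carrier_vec N"
  shows "vec N (\<lambda>i. \<alpha> $ i / real (2 * (i + 1) + 1)) \<bullet> (C_mat N *\<^sub>v \<alpha>)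
    = integral {0..1} (\<lambda>\<zeta>. (\<Sum>i<N. \<alpha> $ i * deriv (basis_fun (i + 1)) \<zeta>)\<^sup>2)"
proof -
  let ?I = "\<lambda>i j. integral {0..1}
    (\<lambda>\<zeta>. deriv (basis_fun (i + 1)) \<zeta> * deriv (basis_fun (j + 1)) \<zeta>)"
  have row: "(C_mat N *\<^sub>v \<alpha>) $ i = real (2 * (i + 1) + 1) * (\<Sum>j<N. ?I i j * \<alpha> $ j)"
    if "i < N" for i
    using that assms
    by (simp add: C_mat_def scalar_prod_def sum_distrib_left mult.assoc lessThan_atLeast0)
  have "vec N (\<lambda>i. \<alpha> $ i / real (2 * (i + 1) + 1)) \<bullet> (C_mat N *\<^sub>v \<alpha>)
      = (\<Sum>i<N. \<alpha> $ i / real (2 * (i + 1) + 1) * (C_mat N *\<^sub>v \<alpha>) $ i)"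
    by (simp add: scalar_prod_def C_mat_def lessThan_atLeast0)
  also have "\<dots> = (\<Sum>i<N. \<alpha> $ i * (\<Sum>j<N. ?I i j * \<alpha> $ j))"
    by (intro sum.cong refl) (simp add: row del: of_nat_add of_nat_mult of_nat_Suc)
  finally show ?thesis
    by (simp only: Gram_quadratic_form[OF continuous_on_deriv_basis_fun])
qed

lemma entropy_vars_inner_Manning_direction:
  fixes u :: "real vec"
  defines "N \<equiv> dim_vec (moments u)"
  shows "entropy_vars g b u \<bullet> vCons 0 (vCons 1 (r_vec N)) = bottom_velocity u"
proof -
  have "vec N (\<lambda>i. moments u $ i / real (2 * (i + 1) + 1)) \<bullet> r_vec N
      = (\<Sum>i<N. moments u $ i)"
    by (simp add: r_vec_def scalar_prod_def lessThan_atLeast0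
        del: of_nat_add of_nat_mult of_nat_Suc)
  then show ?thesis
    by (simp add: entropy_vars_def bottom_velocity_def N_def Let_def)
qed

lemma entropy_vars_inner_viscous_direction_nonneg:
  fixes u :: "real vec"
  defines "N \<equiv> dim_vec (moments u)"
  shows "0 \<le> entropy_vars g b u \<bullet> vCons 0 (vCons 0 (C_mat N *\<^sub>v moments u))"
proof -
  let ?shear = "\<lambda>\<zeta>. \<Sum>i<N. moments u $ i * deriv (basis_fun (i + 1)) \<zeta>"
  have "entropy_vars g b u \<bullet> vCons 0 (vCons 0 (C_mat N *\<^sub>v moments u))
      = vec N (\<lambda>i. moments u $ i / real (2 * (i + 1) + 1)) \<bullet> (C_mat N *\<^sub>v moments u)"
    by (simp add: entropy_vars_def N_def Let_def)
  also have "\<dots> = integral {0..1} (\<lambda>\<zeta>. (?shear \<zeta>)\<^sup>2)"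
    by (rule weighted_C_mat_quadratic_form) (simp add: N_def)
  also have "0 \<le> \<dots>"
  proof (rule Henstock_Kurzweil_Integration.integral_nonneg)
    have "continuous_on {0..1} (\<lambda>\<zeta>. (?shear \<zeta>)\<^sup>2)"
      by (intro continuous_on_power continuous_on_sum continuous_on_mult continuous_on_const
          continuous_on_deriv_basis_fun)
    then show "(\<lambda>\<zeta>. (?shear \<zeta>)\<^sup>2) integrable_on {0..1}"
      by (rule integrable_continuous_interval)
  qed simp
  finally show ?thesis .
qed

text \<open>
  The case of zero height is included because both friction coefficients then vanish by the
  convention \<open>x / 0 = 0\<close>.
\<close>

lemma Manning_friction_entropy_dissipative:
  assumes "0 \<le> \<rho> * g" and "0 \<le> \<nu>" and "0 \<le> height u"
  shows "entropy_vars g b u \<bullet> S_NM \<nu> \<rho> g n u \<le> 0"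
proof -
  define N where "N = dim_vec (moments u)"
  define m where "m = vCons 0 (vCons 1 (r_vec N))"
  define v where "v = vCons 0 (vCons 0 (C_mat N *\<^sub>v moments u))"
  let ?w = "entropy_vars g b u" and ?ub = "bottom_velocity u"
  let ?k = "\<rho> * g * n\<^sup>2 / height u powr (1 / 3)"
  have dims: "?w \<in> carrier_vec (N + 2)" "m \<in> carrier_vec (N + 2)" "v \<in> carrier_vec (N + 2)"
    by (auto intro!: carrier_vecI
        simp: entropy_vars_def m_def v_def N_def r_vec_def C_mat_def Let_def)
  have "?w \<bullet> S_NM \<nu> \<rho> g n u
      = ?w \<bullet> (- (?k * \<bar>?ub\<bar> * ?ub) \<cdot>\<^sub>v m) - ?w \<bullet> (\<nu> / height u \<cdot>\<^sub>v v)"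
    unfolding S_NM_def Let_def N_def[symmetric] m_def[symmetric] v_def[symmetric]
    using dims by (intro scalar_prod_minus_distrib[where n = "N + 2"]) auto
  also have "\<dots> = - (?k * \<bar>?ub\<bar> * ?ub) * (?w \<bullet> m) - \<nu> / height u * (?w \<bullet> v)"
    using dims by simp
  also have "?w \<bullet> m = ?ub"
    unfolding m_def N_def by (rule entropy_vars_inner_Manning_direction)
  finally have "?w \<bullet> S_NM \<nu> \<rho> g n u
      = - (?k * \<bar>?ub\<bar> * ?ub\<^sup>2) - \<nu> / height u * (?w \<bullet> v)"
    by (simp add: power2_eq_square)
  moreover have "0 \<le> ?k * \<bar>?ub\<bar> * ?ub\<^sup>2"
    using assms by simp
  moreover have "0 \<le> \<nu> / height u * (?w \<bullet> v)"
    using assms entropy_vars_inner_viscous_direction_nonneg[of g b u]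
    by (simp add: v_def N_def)
  ultimately show ?thesis
    by linarith
qed

theorem lemma5:
  fixes N :: nat and h u\<^sub>m b \<nu> \<rho> g n :: real and \<alpha> :: "real vec"
  assumes "N \<ge> 1"
    and "h > 0"
    and "\<alpha> \<in> carrier_vec N"
    and "\<nu> > 0" and "\<rho> > 0" and "g > 0" and "n > 0"
  shows "entropy_vars g b (state h u\<^sub>m \<alpha>) \<bullet> S_NM \<nu> \<rho> g n (state h u\<^sub>m \<alpha>) \<le> 0"
  using assms by (intro Manning_friction_entropy_dissipative) simp_all

end
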